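(* Let $f\colon X\to\mathbb{R}$ be a filter on a Lefschetz complex. Then a set $S\subseteq\mathrm{BD}(f)$ is shallow cancelable if and only if it is a down set of the depth poset $\mathcal{D}_f$.
   Context: Fix a field $\mathbb{F}$. A Lefschetz complex is a triple $(X,\dim,\kappa)$ with $X$ a finite set (of cells), $\dim\colon X\to\mathbb{Z}$, and an incidence map $\kappa\colon X\times X\to\mathbb{F}$ such that $\sum_{y\in X}\kappa(z,y)\kappa(y,x)=0$ for all $z,x\in X$, and $\kappa(y,x)\neq 0$ only if $\dim y=\dim x+1$. If $\kappa(y,x)\ne 0$, then $x$ is a facet of $y$ and $y$ is a cofacet of $x$. A filter on $X$ is an injective map $f\colon X\to\mathbb{R}$ with $f(x)<f(y)$ whenever $x$ is a facet of $y$. Birth-death pairs: order $X$ by $f$ and let $\Delta$ be the matrix with rows and columns indexed by $X$ in this order, $\Delta[x,y]=\kappa(y,x)$. A reduced form of $\Delta$ is a matrix $R=\Delta\cdot V$ with $V-\mathrm{Id}$ strictly upper triangular and such that the pivots (lowest non-zero entries) of the non-zero columns of $R$ lie in pairwise different rows. $\mathrm{BD}(f)$ is the set of pairs $(s,t)\in X\times X$ such that column $t$ of $R$ is non-zero and its pivot is in row $s$; this does not depend on the choice of $R$. Shallow pairs: $\mathrm{SH}(f)$ is the set of pairs $(s,t)$ such that $s$ is a facet of $t$, $f(x)\le f(s)$ for all facets $x$ of $t$, and $f(y)\ge f(t)$ for all cofacets $y$ of $s$. One has $\mathrm{SH}(f)\subseteq\mathrm{BD}(f)$. Cancellation: if $s$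 is a facet of $t$, the quotient of $X$ by $(s,t)$ is the Lefschetz complex with cells $X\setminus\{s,t\}$, restricted dimension map, and incidence map $\kappa'(y,x)=\kappa(y,x)-\kappa(t,s)^{-1}\kappa(y,s)\kappa(t,x)$. If $(s,t)\in\mathrm{SH}(f)$, the restriction of $f$ is a filter on the quotient. Shallow orders: let $n=\#\mathrm{BD}(f)$. A shallow (cancellation) order of $f$ is an enumeration $\Phi=(\varphi_1,\dots,\varphi_n)$ of $\mathrm{BD}(f)$ such that, setting $X_0=X$, $f_0=f$, and letting $X_i$ be the quotient of $X_{i-1}$ by $\varphi_i$ and $f_i=f|_{X_i}$, one has $\varphi_i\in\mathrm{SH}(f_{i-1})$ for $i=1,\dots,n$. It is identified with the linear order $\varphi_i\le_\Phi\varphi_j\iff i\le j$. Depth poset: $\mathcal{D}_f$ is the partial order on $\mathrm{BD}(f)$ that is the intersection of all shallow orders of $f$: $\chi\le_f\xi$ iff $\chi\le_\Phi\xi$ for every shallow order $\Phi$ of $f$. A set $S\subseteq\mathrm{BD}(f)$ is a down set of $\mathcal{D}_f$ if $\xi\in S$ and $\chi\le_f\xi$ imply $\chi\in S$. A set $S\subseteq\mathrm{BD}(f)$ is shallow cancelable if some ordering of $S$ is a prefix of a shallow order, i.e. $S=\{\varphi_1,\dots,\varphi_k\}$ for some shallow order $(\varphi_1,\dots,\varphi_n)$ and some $0\le k\le n$. *)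

theory Defs
  imports Complex_Main
begin

record ('a, 'k) lcomplex =
  cells :: "'a set"
  cdim :: "'a \<Rightarrow> int"
  inc :: "'a \<Rightarrow> 'a \<Rightarrow> 'k"

text \<open>
  The values of \<^const>\<open>cdim\<close> and \<^const>\<open>inc\<close> outside the set of cells are irrelevant: all notions
  below only look at cells. In particular, restrictions of the dimension map and of the
  filter to a quotient are represented by the unrestricted functions.
\<close>

definition lefschetz_complex :: "('a, 'k::field) lcomplex \<Rightarrow> bool" where
  "lefschetz_complex X \<longleftrightarrow>
     finite (cells X) \<and>
     (\<forall>z\<in>cells X. \<forall>x\<in>cells X. (\<Sum>y\<in>cells X. inc X z y * inc X y x) = 0) \<and>
     (\<forall>y\<in>cells X. \<forall>x\<in>cells X. inc X y x \<noteq> 0 \<longrightarrow> cdim X y = cdim X x + 1)"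

definition facet :: "('a, 'k::field) lcomplex \<Rightarrow> 'a \<Rightarrow> 'a \<Rightarrow> bool" where
  "facet X x y \<longleftrightarrow> x \<in> cells X \<and> y \<in> cells X \<and> inc X y x \<noteq> 0"

definition lfilter :: "('a, 'k::field) lcomplex \<Rightarrow> ('a \<Rightarrow> real) \<Rightarrow> bool" where
  "lfilter X f \<longleftrightarrow> inj_on f (cells X) \<and> (\<forall>x y. facet X x y \<longrightarrow> f x < f y)"

definition boundary_matrix :: "('a, 'k::field) lcomplex \<Rightarrow> 'a \<Rightarrow> 'a \<Rightarrow> 'k" where
  "boundary_matrix X x y = inc X y x"

text \<open>
  Matrices are functions of a row and a column index in the set of cells, ordered by the filter
  values, so "lower" in a column means a larger filter value.
\<close>

definition strictly_upper :: "'a set \<Rightarrow> ('a \<Rightarrow> real) \<Rightarrow> ('a \<Rightarrow> 'a \<Rightarrow> 'k::field) \<Rightarrow> bool" where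
  "strictly_upper A f M \<longleftrightarrow> (\<forall>x\<in>A. \<forall>y\<in>A. f y \<le> f x \<longrightarrow> M x y = 0)"

text \<open>\<open>is_pivot A f R s t\<close>: column \<open>t\<close> of \<open>R\<close> is non-zero and its lowest non-zero entry is in row \<open>s\<close>.\<close>

definition is_pivot :: "'a set \<Rightarrow> ('a \<Rightarrow> real) \<Rightarrow> ('a \<Rightarrow> 'a \<Rightarrow> 'k::field) \<Rightarrow> 'a \<Rightarrow> 'a \<Rightarrow> bool" where
  "is_pivot A f R s t \<longleftrightarrow>
     s \<in> A \<and> t \<in> A \<and> R s t \<noteq> 0 \<and> (\<forall>x\<in>A. f s < f x \<longrightarrow> R x t = 0)"

definition reduced_form ::
  "('a, 'k::field) lcomplex \<Rightarrow> ('a \<Rightarrow> real) \<Rightarrow> ('a \<Rightarrow> 'a \<Rightarrow> 'k) \<Rightarrow> bool" where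
  "reduced_form X f R \<longleftrightarrow>
     (\<exists>V. strictly_upper (cells X) f (\<lambda>x y. V x y - (if x = y then 1 else 0)) \<and>
          (\<forall>x\<in>cells X. \<forall>t\<in>cells X. R x t = (\<Sum>y\<in>cells X. boundary_matrix X x y * V y t))) \<and>
     (\<forall>s t t'. is_pivot (cells X) f R s t \<and> is_pivot (cells X) f R s t' \<longrightarrow> t = t')"

text \<open>
  For a filter on a Lefschetz complex a reduced form exists and the pivot positions are the same
  for all reduced forms, so the existential quantifier selects the pivots of any one of them.
\<close>

definition BD :: "('a, 'k::field) lcomplex \<Rightarrow> ('a \<Rightarrow> real) \<Rightarrow> ('a \<times> 'a) set" where
  "BD X f = {(s, t). \<exists>R. reduced_form X f R \<and> is_pivot (cells X) f R s t}"

definition SH :: "('a, 'k::field) lcomplex \<Rightarrow> ('a \<Rightarrow> real) \<Rightarrow> ('a \<times> 'a) set" where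
  "SH X f = {(s, t). facet X s t \<and>
     (\<forall>x. facet X x t \<longrightarrow> f x \<le> f s) \<and> (\<forall>y. facet X s y \<longrightarrow> f t \<le> f y)}"

definition quotient_complex ::
  "('a, 'k::field) lcomplex \<Rightarrow> 'a \<times> 'a \<Rightarrow> ('a, 'k) lcomplex" where
  "quotient_complex X = (\<lambda>(s, t).
     \<lparr> cells = cells X - {s, t},
       cdim = cdim X,
       inc = (\<lambda>y x. inc X y x - inverse (inc X t s) * inc X y s * inc X t x) \<rparr>)"

text \<open>Cancellation of the listed pairs one after the other, from left to right.\<close>

definition cancel_all ::
  "('a, 'k::field) lcomplex \<Rightarrow> ('a \<times> 'a) list \<Rightarrow> ('a, 'k) lcomplex" where
  "cancel_all X \<phi>s = foldl quotient_complex X \<phi>s"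

text \<open>Positions in \<open>\<Phi>\<close> are counted from 0.\<close>

definition shallow_order ::
  "('a, 'k::field) lcomplex \<Rightarrow> ('a \<Rightarrow> real) \<Rightarrow> ('a \<times> 'a) list \<Rightarrow> bool" where
  "shallow_order X f \<Phi> \<longleftrightarrow>
     distinct \<Phi> \<and> set \<Phi> = BD X f \<and>
     (\<forall>i<length \<Phi>. \<Phi> ! i \<in> SH (cancel_all X (take i \<Phi>)) f)"

definition list_le :: "'b list \<Rightarrow> 'b \<Rightarrow> 'b \<Rightarrow> bool" where
  "list_le \<Phi> \<chi> \<xi> \<longleftrightarrow> (\<exists>i j. i \<le> j \<and> j < length \<Phi> \<and> \<Phi> ! i = \<chi> \<and> \<Phi> ! j = \<xi>)"

definition depth_le ::
  "('a, 'k::field) lcomplex \<Rightarrow> ('a \<Rightarrow> real) \<Rightarrow> 'a \<times> 'a \<Rightarrow> 'a \<times> 'a \<Rightarrow> bool" where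
  "depth_le X f \<chi> \<xi> \<longleftrightarrow>
     \<chi> \<in> BD X f \<and> \<xi> \<in> BD X f \<and> (\<forall>\<Phi>. shallow_order X f \<Phi> \<longrightarrow> list_le \<Phi> \<chi> \<xi>)"

definition depth_down_set ::
  "('a, 'k::field) lcomplex \<Rightarrow> ('a \<Rightarrow> real) \<Rightarrow> ('a \<times> 'a) set \<Rightarrow> bool" where
  "depth_down_set X f S \<longleftrightarrow>
     S \<subseteq> BD X f \<and> (\<forall>\<chi> \<xi>. \<xi> \<in> S \<longrightarrow> depth_le X f \<chi> \<xi> \<longrightarrow> \<chi> \<in> S)"

definition shallow_cancelable ::
  "('a, 'k::field) lcomplex \<Rightarrow> ('a \<Rightarrow> real) \<Rightarrow> ('a \<times> 'a) set \<Rightarrow> bool" where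
  "shallow_cancelable X f S \<longleftrightarrow>
     (\<exists>\<Phi> k. shallow_order X f \<Phi> \<and> k \<le> length \<Phi> \<and> S = set (take k \<Phi>))"

end

theory Submission
  imports Defs
begin

text \<open>
  Call a set of pairs feasible if its members can be cancelled one after the other, each being
  shallow when its turn comes. The theorem holds because the feasible sets are closed under union
  and intersection. Given this, the feasible sets containing a pair \<open>\<xi>\<close> have a least member
  \<open>D \<xi>\<close>, and every pair in \<open>D \<xi>\<close> precedes \<open>\<xi>\<close> in every shallow order, since the prefix of a
  shallow order that ends at \<open>\<xi>\<close> is feasible. So a down set \<open>S\<close> of the depth poset contains
  \<open>D \<xi>\<close> for each of its members \<open>\<xi>\<close>; hence it is the union of the sets \<open>D \<xi>\<close>, and is feasible.
  That prefixes are down sets is clear.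

  Closure under both operations is a formal consequence of three facts about two distinct shallow
  pairs \<open>a\<close> and \<open>b\<close> of one complex. Cancelling \<open>a\<close> leaves \<open>b\<close> shallow
  (\<open>shallow_persist\<close>); the two cancellations commute (\<open>shallow_commute\<close>); and a pair that is
  shallow after cancelling \<open>a\<close> and also after cancelling \<open>b\<close> was shallow before
  (\<open>shallow_meet\<close>). The first two give unions: two cancellation sequences can be merged. The third
  gives intersections: if two disjoint sequences both make a pair shallow, then the third fact,
  applied square by square in the grid of their merged prefixes, shows that the pair was shallow
  from the start.

  It remains to see that maximal cancellation sequences use up exactly the birth-death pairs. As
  long as some incidence is left, a facet relation with the smallest difference of filter values is
  a shallow pair (\<open>SH_nonempty\<close>). Cancelling a shallow pair removes this pair from the birth-death
  pairs and changes nothing else (\<open>BD_quotient\<close>). The latter is seen without matrix reductions: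
  \<open>(s, t)\<close> is a birth-death pair iff \<open>t\<close> is the first cell such that some chain of cells up to
  \<open>t\<close> has a boundary with leading cell \<open>s\<close> (\<open>BD_iff_first_killing\<close>), and such chains can be
  transferred between a complex and its quotient (\<open>killed_by_quotient\<close>).
\<close>

section \<open>Processes whose event sets form a distributive lattice\<close>

text \<open>
  The combinatorics only needs states with available events. In the application a state is a
  complex, the available events are its shallow pairs, firing is cancellation, and the pool of
  events that are still to happen consists of the birth-death pairs.
\<close>

locale firing_process =
  fixes good :: "'s \<Rightarrow> bool"
    and avail :: "'s \<Rightarrow> 'e set"
    and fire :: "'s \<Rightarrow> 'e \<Rightarrow> 's"
    and pool :: "'s \<Rightarrow> 'e set"
  assumes good_fire: "good x \<Longrightarrow> a \<in> avail x \<Longrightarrow> good (fire x a)"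
    and finite_pool: "good x \<Longrightarrow> finite (pool x)"
    and avail_pool: "good x \<Longrightarrow> avail x \<subseteq> pool x"
    and pool_fire: "good x \<Longrightarrow> a \<in> avail x \<Longrightarrow> pool (fire x a) = pool x - {a}"
    and progress: "good x \<Longrightarrow> pool x \<noteq> {} \<Longrightarrow> avail x \<noteq> {}"
    and persist: "good x \<Longrightarrow> a \<in> avail x \<Longrightarrow> b \<in> avail x \<Longrightarrow> a \<noteq> b \<Longrightarrow> b \<in> avail (fire x a)"
    and commute: "good x \<Longrightarrow> a \<in> avail x \<Longrightarrow> b \<in> avail x \<Longrightarrow> a \<noteq> b \<Longrightarrow>
                    fire (fire x a) b = fire (fire x b) a"
    and meet: "good x \<Longrightarrow> a \<in> avail x \<Longrightarrow> b \<in> avail x \<Longrightarrow> a \<noteq> b \<Longrightarrow>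
                 e \<in> avail (fire x a) \<Longrightarrow> e \<in> avail (fire x b) \<Longrightarrow> e \<in> avail x"
begin

fun run :: "'s \<Rightarrow> 'e list \<Rightarrow> bool" where
  "run x [] \<longleftrightarrow> True"
| "run x (a # as) \<longleftrightarrow> a \<in> avail x \<and> run (fire x a) as"

definition feasible :: "'s \<Rightarrow> 'e set \<Rightarrow> bool" where
  "feasible x A \<longleftrightarrow> (\<exists>as. run x as \<and> set as = A)"

lemma run_append: "run x (as @ bs) \<longleftrightarrow> run x as \<and> run (foldl fire x as) bs"
  by (induction as arbitrary: x) auto

lemma run_iff_nth:
  "run x as \<longleftrightarrow> (\<forall>i<length as. as ! i \<in> avail (foldl fire x (take i as)))"
proof (induction as arbitrary: x)
  case Nil
  then show ?case by simp
next
  case (Cons a as)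
  show ?case by (auto simp: Cons.IH less_Suc_eq_0_disj All_less_Suc2)
qed

lemma run_good: "good x \<Longrightarrow> run x as \<Longrightarrow> good (foldl fire x as)"
  by (induction as arbitrary: x) (auto simp: good_fire)

lemma run_pool:
  "good x \<Longrightarrow> run x as \<Longrightarrow>
     distinct as \<and> set as \<subseteq> pool x \<and> pool (foldl fire x as) = pool x - set as"
proof (induction as arbitrary: x)
  case Nil
  then show ?case by simp
next
  case (Cons a as)
  then have a: "a \<in> avail x" and r: "run (fire x a) as" by auto
  note IH = Cons.IH[OF good_fire[OF Cons.prems(1) a] r]
  show ?case using IH a pool_fire[OF Cons.prems(1) a] avail_pool[OF Cons.prems(1)] by auto
qed

lemma run_extend:
  assumes "good x"
  shows "\<exists>as. run x as \<and> set as = pool x"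
  using assms
proof (induction "card (pool x)" arbitrary: x rule: less_induct)
  case less
  show ?case
  proof (cases "pool x = {}")
    case True
    then show ?thesis by (intro exI[of _ "[]"]) simp
  next
    case False
    then obtain a where a: "a \<in> avail x" using progress less.prems by blast
    then have p: "pool (fire x a) = pool x - {a}" "a \<in> pool x"
      using pool_fire avail_pool less.prems by blast+
    then have "card (pool (fire x a)) < card (pool x)"
      using finite_pool[OF less.prems] by (metis card_Diff1_less)
    from less.hyps[OF this good_fire[OF less.prems a]] obtain as
      where "run (fire x a) as" "set as = pool (fire x a)" by blast
    then show ?thesis using a p by (intro exI[of _ "a # as"]) auto
  qed
qed

lemma run_complete:
  assumes "good x" "run x as"
  shows "\<exists>bs. run x (as @ bs) \<and> set (as @ bs) = pool x"
proof -
  obtain bs where "run (foldl fire x as) bs" "set bs = pool (foldl fire x as)"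
    using run_extend[OF run_good[OF assms]] by blast
  then show ?thesis using assms run_pool[OF assms] by (intro exI[of _ bs]) (auto simp: run_append)
qed

text \<open>
  An available event stays available until it is fired, and it can be moved past a sequence of other
  events by repeated transposition.
\<close>

lemma run_pass:
  assumes "good x" "a \<in> avail x" "run x bs" "a \<notin> set bs"
  shows "a \<in> avail (foldl fire x bs) \<and> run (fire x a) bs \<and>
         foldl fire (fire x a) bs = fire (foldl fire x bs) a"
  using assms
proof (induction bs arbitrary: x)
  case Nil
  then show ?case by simp
next
  case (Cons b bs)
  then have b: "b \<in> avail x" "run (fire x b) bs" "a \<noteq> b" "a \<notin> set bs" by auto
  have "a \<in> avail (fire x b)" "b \<in> avail (fire x a)"
    using persist Cons.prems b by metis+
  moreover have "fire (fire x a) b = fire (fire x b) a" using commute Cons.prems b by metis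
  ultimately show ?case
    using Cons.IH[OF good_fire[OF Cons.prems(1) b(1)] _ b(2) b(4)] by simp
qed

text \<open>
  Events in front of \<open>a\<close> can be postponed until after \<open>a\<close>, because \<open>a\<close> is available already.
\<close>

lemma run_pull_front:
  assumes "good x" "a \<in> avail x" "run x bs" "a \<in> set bs"
  shows "run (fire x a) (remove1 a bs)"
proof -
  obtain cs ds where bs: "bs = cs @ a # ds" and a: "a \<notin> set cs"
    using split_list_first[OF assms(4)] by blast
  have c: "run x cs" and d: "run (fire (foldl fire x cs) a) ds"
    using assms(3) by (auto simp: bs run_append)
  from run_pass[OF assms(1,2) c a] d show ?thesis
    using a by (simp add: bs remove1_append run_append)
qed

lemma run_drop_front:
  assumes "good x" "a \<in> avail x" "run x bs"
  shows "\<exists>cs. run (fire x a) cs \<and> set cs = set bs - {a}"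
proof (cases "a \<in> set bs")
  case True
  then show ?thesis
    using run_pull_front[OF assms True] run_pool[OF assms(1,3)] by (metis set_remove1_eq)
next
  case False
  then show ?thesis using run_pass[OF assms False] by auto
qed

text \<open>
  Merging of runs: after \<open>as\<close>, the rest of \<open>bs\<close> can still be carried out. One removes the events
  of \<open>as\<close> from \<open>bs\<close> one at a time.
\<close>

lemma run_residual:
  assumes "good x" "run x as" "run x bs"
  shows "\<exists>cs. run (foldl fire x as) cs \<and> set cs = set bs - set as"
  using assms
proof (induction as arbitrary: x bs)
  case Nil
  then show ?case by auto
next
  case (Cons a as)
  then have a: "a \<in> avail x" "run (fire x a) as" by auto
  obtain cs where cs: "run (fire x a) cs" "set cs = set bs - {a}"
    using run_drop_front[OF Cons.prems(1) a(1) Cons.prems(3)] by blast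
  obtain ds where "run (foldl fire (fire x a) as) ds" "set ds = set cs - set as"
    using Cons.IH[OF good_fire[OF Cons.prems(1) a(1)] a(2) cs(1)] by blast
  then show ?case using cs by (intro exI[of _ ds]) auto
qed

lemma feasible_empty: "feasible x {}"
  unfolding feasible_def by (intro exI[of _ "[]"]) simp

lemma feasible_Un:
  assumes "good x" "feasible x A" "feasible x B"
  shows "feasible x (A \<union> B)"
proof -
  obtain as bs where ab: "run x as" "set as = A" "run x bs" "set bs = B"
    using assms by (auto simp: feasible_def)
  then obtain cs where "run (foldl fire x as) cs" "set cs = B - A"
    using run_residual[OF assms(1)] by blast
  then show ?thesis unfolding feasible_def
    using ab by (intro exI[of _ "as @ cs"]) (auto simp: run_append)
qed

text \<open>
  One strip of the grid formed by two runs. At every point along \<open>bs\<close> the event \<open>e\<close> is available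
  after one more step \<open>a\<close>, and it is available at the end of \<open>bs\<close>; the axiom \<open>meet\<close> carries this
  back along \<open>bs\<close> to the start.
\<close>

lemma avail_descend_step:
  assumes "good x" "a \<in> avail x" "e \<in> avail (fire x a)"
    and "run x bs" "a \<notin> set bs" "e \<in> avail (foldl fire x bs)"
  shows "e \<in> avail x"
  using assms
proof (induction bs arbitrary: x)
  case Nil
  then show ?case by simp
next
  case (Cons b bs)
  then have b: "b \<in> avail x" "run (fire x b) bs" "a \<noteq> b" "a \<notin> set bs" by auto
  have "e \<noteq> b"
    using run_pool[OF Cons.prems(1,4)] avail_pool[OF run_good[OF Cons.prems(1,4)]] Cons.prems(6)
    by auto
  have gb: "good (fire x b)" and ga: "good (fire x a)"
    using good_fire Cons.prems b by auto
  have "b \<in> avail (fire x a)" "a \<in> avail (fire x b)" using persist Cons.prems b by metis+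
  then have "e \<in> avail (fire (fire x a) b)" using persist[OF ga] Cons.prems \<open>e \<noteq> b\<close> by metis
  then have "e \<in> avail (fire (fire x b) a)" using commute Cons.prems b by metis
  then have "e \<in> avail (fire x b)"
    using Cons.IH[OF gb \<open>a \<in> avail (fire x b)\<close> _ b(2) b(4)] Cons.prems(6) by simp
  then show ?case using meet Cons.prems b by metis
qed

text \<open>
  The grid argument: disjoint runs span a grid of states, and the availability of \<open>e\<close> at the two
  far corners is brought back to their common origin strip by strip.
\<close>

lemma avail_descend:
  assumes "good x" "run x as" "run x bs" "set as \<inter> set bs = {}"
    and "e \<in> avail (foldl fire x as)" "e \<in> avail (foldl fire x bs)"
  shows "e \<in> avail x"
  using assms
proof (induction as arbitrary: x)
  case Nil
  then show ?case by simp
next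
  case (Cons a as)
  then have a: "a \<in> avail x" "run (fire x a) as" "a \<notin> set bs" "set as \<inter> set bs = {}" by auto
  note p = run_pass[OF Cons.prems(1) a(1) Cons.prems(3) a(3)]
  have "e \<noteq> a"
    using run_pool[OF Cons.prems(1,2)] avail_pool[OF run_good[OF Cons.prems(1,2)]] Cons.prems(5)
    by auto
  then have "e \<in> avail (foldl fire (fire x a) bs)"
    using p persist[OF run_good[OF Cons.prems(1,3)]] Cons.prems(6) by metis
  then have "e \<in> avail (fire x a)"
    using Cons.IH[OF good_fire[OF Cons.prems(1) a(1)] a(2) _ a(4)] p Cons.prems(5) by simp
  then show ?case using avail_descend_step Cons.prems a by metis
qed

text \<open>
  The first event of \<open>as\<close> that also occurs in \<open>bs\<close> is enabled by two disjoint runs, so it is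
  available at the start and can be pulled to the front of both runs. Induction on the length takes
  care of what is left.
\<close>

lemma feasible_Int_runs:
  assumes "good x" "run x as" "run x bs"
  shows "feasible x (set as \<inter> set bs)"
  using assms
proof (induction "length as" arbitrary: x as bs rule: less_induct)
  case less
  show ?case
  proof (cases "set as \<inter> set bs = {}")
    case True
    then show ?thesis by (simp add: feasible_empty)
  next
    case False
    then have "\<exists>e\<in>set as. e \<in> set bs" by blast
    then obtain as1 e as2 where as: "as = as1 @ e # as2" "e \<in> set bs" "\<forall>y\<in>set as1. y \<notin> set bs"
      using split_list_first_propE[of as "\<lambda>e. e \<in> set bs"] by metis
    obtain bs1 bs2 where bs: "bs = bs1 @ e # bs2"
      using split_list as(2) by metis
    have e: "e \<in> avail x"
    proof (rule avail_descend[OF less.prems(1)])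
      show "run x as1" "run x bs1" "e \<in> avail (foldl fire x as1)" "e \<in> avail (foldl fire x bs1)"
        using less.prems by (auto simp: as(1) bs run_append)
      show "set as1 \<inter> set bs1 = {}" using as(3) by (auto simp: bs)
    qed
    have ein: "e \<in> set as" "e \<in> set bs" by (auto simp: as(1) bs)
    have ra: "run (fire x e) (remove1 e as)" "run (fire x e) (remove1 e bs)"
      using run_pull_front less.prems e ein by blast+
    have "length (remove1 e as) < length as"
      using ein(1) length_pos_if_in_set[OF ein(1)] by (simp add: length_remove1)
    from less.hyps[OF this good_fire[OF less.prems(1) e] ra] obtain cs
      where cs: "run (fire x e) cs" "set cs = set (remove1 e as) \<inter> set (remove1 e bs)"
      by (auto simp: feasible_def)
    have "set (e # cs) = set as \<inter> set bs"
      using cs(2) ein run_pool[OF less.prems(1,2)] run_pool[OF less.prems(1,3)] by auto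
    moreover have "run x (e # cs)" using e cs by simp
    ultimately show ?thesis unfolding feasible_def by blast
  qed
qed

lemma feasible_Int:
  "good x \<Longrightarrow> feasible x A \<Longrightarrow> feasible x B \<Longrightarrow> feasible x (A \<inter> B)"
  using feasible_Int_runs by (auto simp: feasible_def)

lemma feasible_Union:
  assumes "good x" "finite \<A>" "\<And>A. A \<in> \<A> \<Longrightarrow> feasible x A"
  shows "feasible x (\<Union>\<A>)"
  using assms(2,3)
  by (induction rule: finite_induct) (auto simp: feasible_empty intro: feasible_Un[OF assms(1)])

lemma feasible_Inter:
  assumes "good x" "finite \<A>" "\<A> \<noteq> {}" "\<And>A. A \<in> \<A> \<Longrightarrow> feasible x A"
  shows "feasible x (\<Inter>\<A>)"
  using assms(2-4)
  by (induction rule: finite_ne_induct) (auto intro: feasible_Int[OF assms(1)])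

lemma take_list_le:
  assumes "list_le \<Phi> \<chi> \<xi>" "distinct \<Phi>" "\<xi> \<in> set (take k \<Phi>)"
  shows "\<chi> \<in> set (take k \<Phi>)"
proof -
  obtain i j where ij: "i \<le> j" "j < length \<Phi>" "\<Phi> ! i = \<chi>" "\<Phi> ! j = \<xi>"
    using assms(1) by (auto simp: list_le_def)
  obtain l where "l < length \<Phi>" "l < k" "\<Phi> ! l = \<xi>"
    using assms(3) by (auto simp: in_set_conv_nth)
  then have "j < k" using assms(2) ij by (metis nth_eq_iff_index_eq)
  then show ?thesis using ij by (auto simp: in_set_conv_nth intro!: exI[of _ i])
qed

text \<open>
  The finitely many feasible sets containing \<open>\<xi>\<close> intersect in a least one, \<open>D \<xi>\<close>, and a down set
  is the union of the sets \<open>D \<xi>\<close> of its members.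
\<close>

theorem feasible_iff_down_set:
  assumes x: "good x" and S: "S \<subseteq> pool x"
  shows "feasible x S \<longleftrightarrow>
    (\<forall>\<chi>\<in>pool x. \<forall>\<xi>\<in>S. (\<forall>\<Phi>. run x \<Phi> \<and> set \<Phi> = pool x \<longrightarrow> list_le \<Phi> \<chi> \<xi>) \<longrightarrow> \<chi> \<in> S)"
    (is "_ \<longleftrightarrow> ?down")
proof
  assume "feasible x S"
  then obtain as where as: "run x as" "set as = S" by (auto simp: feasible_def)
  obtain bs where bs: "run x (as @ bs)" "set (as @ bs) = pool x"
    using run_complete[OF x as(1)] by blast
  have "distinct (as @ bs)" using run_pool[OF x bs(1)] by blast
  then show ?down using take_list_le[of "as @ bs" _ _ "length as"] as bs by auto
next
  assume down: ?down
  define D where "D \<xi> = \<Inter>{A. feasible x A \<and> \<xi> \<in> A}" for \<xi>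
  have fin: "finite {A. feasible x A \<and> \<xi> \<in> A}" for \<xi>
  proof (rule finite_subset)
    show "{A. feasible x A \<and> \<xi> \<in> A} \<subseteq> Pow (pool x)"
      using run_pool[OF x] by (auto simp: feasible_def)
  qed (simp add: finite_pool[OF x])
  have pool: "feasible x (pool x)" using run_extend[OF x] by (simp add: feasible_def)
  have D: "feasible x (D \<xi>)" if "\<xi> \<in> S" for \<xi>
    unfolding D_def using that S pool by (intro feasible_Inter[OF x fin]) auto
  have DS: "D \<xi> \<subseteq> S" if xi: "\<xi> \<in> S" for \<xi>
  proof
    fix \<chi> assume chi: "\<chi> \<in> D \<xi>"
    have "list_le \<Phi> \<chi> \<xi>" if P: "run x \<Phi>" "set \<Phi> = pool x" for \<Phi>
    proof -
      have "\<xi> \<in> set \<Phi>" using P(2) xi S by blast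
      then obtain j where j: "j < length \<Phi>" "\<Phi> ! j = \<xi>" by (auto simp: in_set_conv_nth)
      have "run x (take (Suc j) \<Phi>)"
        using P(1) run_append[of x "take (Suc j) \<Phi>" "drop (Suc j) \<Phi>"] by simp
      moreover have "\<xi> \<in> set (take (Suc j) \<Phi>)" using j by (auto simp: take_Suc_conv_app_nth)
      ultimately have "\<chi> \<in> set (take (Suc j) \<Phi>)"
        using chi by (auto simp: D_def feasible_def)
      then obtain i where "i < length \<Phi>" "i < Suc j" "\<Phi> ! i = \<chi>"
        by (auto simp: in_set_conv_nth)
      then show ?thesis using j unfolding list_le_def by (intro exI[of _ i] exI[of _ j]) auto
    qed
    moreover have "\<chi> \<in> pool x" using chi pool xi S by (auto simp: D_def)
    ultimately show "\<chi> \<in> S" using down xi by blast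
  qed
  have "\<Union>(D ` S) = S" using DS by (auto simp: D_def)
  moreover have "feasible x (\<Union>(D ` S))"
    using D finite_subset[OF S finite_pool[OF x]] by (intro feasible_Union[OF x]) auto
  ultimately show "feasible x S" by simp
qed

end

section \<open>Birth-death pairs and boundaries of chains\<close>

definition bd :: "('a, 'k::field) lcomplex \<Rightarrow> ('a \<Rightarrow> 'k) \<Rightarrow> 'a \<Rightarrow> 'k" where
  "bd X c x = (\<Sum>y\<in>cells X. c y * inc X y x)"

definition leading :: "'a set \<Rightarrow> ('a \<Rightarrow> real) \<Rightarrow> ('a \<Rightarrow> 'k::field) \<Rightarrow> 'a \<Rightarrow> bool" where
  "leading A f z s \<longleftrightarrow> s \<in> A \<and> z s \<noteq> 0 \<and> (\<forall>x\<in>A. f s < f x \<longrightarrow> z x = 0)"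

definition supported :: "('a, 'k::field) lcomplex \<Rightarrow> ('a \<Rightarrow> real) \<Rightarrow> real \<Rightarrow> ('a \<Rightarrow> 'k) \<Rightarrow> bool" where
  "supported X f r c \<longleftrightarrow> (\<forall>y\<in>cells X. c y \<noteq> 0 \<longrightarrow> f y \<le> r)"

text \<open>
  In homological terms, a class born at \<open>s\<close> has become trivial at filter level \<open>r\<close>.
\<close>

definition killed_by :: "('a, 'k::field) lcomplex \<Rightarrow> ('a \<Rightarrow> real) \<Rightarrow> real \<Rightarrow> 'a \<Rightarrow> bool" where
  "killed_by X f r s \<longleftrightarrow> (\<exists>c. supported X f r c \<and> leading (cells X) f (bd X c) s)"

lemma bd_diff_scale: "bd X (\<lambda>y. c y - k * d y) x = bd X c x - k * bd X d x"
  by (simp add: bd_def sum_subtractf sum_distrib_left algebra_simps)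

lemma is_pivot_iff_leading:
  "is_pivot A f R s t \<longleftrightarrow> t \<in> A \<and> leading A f (\<lambda>x. R x t) s"
  by (auto simp: is_pivot_def leading_def)

lemma argmax_exists:
  fixes f :: "'a \<Rightarrow> real"
  assumes "finite B" "B \<noteq> {}"
  obtains t where "t \<in> B" "\<And>y. y \<in> B \<Longrightarrow> f y \<le> f t"
proof -
  have "Max (f ` B) \<in> f ` B" using assms by (intro Max_in) auto
  then obtain t where "t \<in> B" "f t = Max (f ` B)" by auto
  then show ?thesis using assms(1) by (intro that[of t]) auto
qed

lemma leading_exists:
  assumes "finite A" "x \<in> A" "z x \<noteq> 0"
  shows "\<exists>s. leading A f z s \<and> f x \<le> f s"
proof -
  let ?B = "{y\<in>A. z y \<noteq> 0}"
  have fin: "finite ?B" "?B \<noteq> {}" using assms by auto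
  obtain s where s: "s \<in> ?B" "\<And>y. y \<in> ?B \<Longrightarrow> f y \<le> f s"
    using argmax_exists[OF fin, of f] by blast
  then show ?thesis using assms unfolding leading_def by (intro exI[of _ s]) force
qed

text \<open>
  Turns the strict bounds that come from the filter order into the non-strict bounds used by
  \<^const>\<open>supported\<close>.
\<close>

lemma below_strict_bound:
  fixes f :: "'a \<Rightarrow> real"
  assumes "finite A"
  shows "\<exists>r<b. \<forall>y\<in>A. f y < b \<longrightarrow> f y \<le> r"
proof -
  let ?M = "insert (b - 1) (f ` {y\<in>A. f y < b})"
  have "Max ?M \<in> ?M" using assms by (intro Max_in) auto
  moreover have "f y \<le> Max ?M" if "y \<in> A" "f y < b" for y using assms that by (intro Max_ge) auto
  ultimately show ?thesis by (intro exI[of _ "Max ?M"]) auto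
qed

lemma killed_by_cell:
  assumes "finite (cells X)" "killed_by X f r s"
  shows "\<exists>t\<in>cells X. f t \<le> r \<and> killed_by X f (f t) s"
proof -
  obtain c where c: "supported X f r c" "leading (cells X) f (bd X c) s"
    using assms(2) by (auto simp: killed_by_def)
  let ?B = "{y\<in>cells X. c y \<noteq> 0}"
  have "bd X c s \<noteq> 0" using c by (simp add: leading_def)
  then have "?B \<noteq> {}" unfolding bd_def by (auto intro: sum.neutral)
  moreover have "finite ?B" using assms by auto
  ultimately obtain t where t: "t \<in> ?B" "\<And>y. y \<in> ?B \<Longrightarrow> f y \<le> f t"
    using argmax_exists[of ?B f] by blast
  then have "supported X f (f t) c" by (auto simp: supported_def)
  then show ?thesis using t c by (auto simp: killed_by_def supported_def)
qed

text \<open>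
  Since the pivots of a reduced form lie in different rows, they cannot cancel each other in a
  combination of columns; hence every leading cell of a boundary is the pivot of one of the columns
  involved. The induction removes the last cell \<open>t\<close> of a down-closed set carrying the chain, by
  subtracting a multiple of the chain whose boundary is column \<open>t\<close>.
\<close>

lemma leading_of_reduced:
  assumes fin: "finite (cells X)" and inj: "inj_on f (cells X)"
    and V: "strictly_upper (cells X) f (\<lambda>x y. V x y - (if x = y then 1 else 0))"
    and R: "\<forall>x\<in>cells X. \<forall>t\<in>cells X. R x t = bd X (\<lambda>y. V y t) x"
    and uniq: "\<forall>s t t'. is_pivot (cells X) f R s t \<and> is_pivot (cells X) f R s t' \<longrightarrow> t = t'"
    and c: "supported X f r c" "leading (cells X) f (bd X c) s"
  shows "\<exists>y\<in>cells X. f y \<le> r \<and> is_pivot (cells X) f R s y"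
proof -
  have main: "\<exists>y\<in>D. is_pivot (cells X) f R s y"
    if "D \<subseteq> cells X" "\<forall>y\<in>D. \<forall>x\<in>cells X. f x \<le> f y \<longrightarrow> x \<in> D"
      "\<forall>y\<in>cells X. c y \<noteq> 0 \<longrightarrow> y \<in> D" "leading (cells X) f (bd X c) s" for D c s
    using that
  proof (induction "card D" arbitrary: D c s rule: less_induct)
    case less
    have finD: "finite D" using less.prems(1) fin finite_subset by blast
    have "bd X c s \<noteq> 0" using less.prems by (simp add: leading_def)
    then have "D \<noteq> {}" using less.prems(3) unfolding bd_def by (auto intro: sum.neutral)
    then obtain t where t: "t \<in> D" "\<And>y. y \<in> D \<Longrightarrow> f y \<le> f t"
      using argmax_exists[OF finD, of f] by blast
    have tX: "t \<in> cells X" using t less.prems by blast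
    define c' where "c' = (\<lambda>y. c y - c t * V y t)"
    have bd': "bd X c' x = bd X c x - c t * R x t" if "x \<in> cells X" for x
      using R that tX by (simp add: c'_def bd_diff_scale)
    have card: "card (D - {t}) < card D" using t finD by (metis card_Diff1_less)
    have down: "\<forall>y\<in>D - {t}. \<forall>x\<in>cells X. f x \<le> f y \<longrightarrow> x \<in> D - {t}"
      using less.prems(1,2) t inj tX by (metis Diff_iff antisym inj_onD insertE insertI1 empty_iff subsetD)
    have Vy: "V y t = (if y = t then 1 else 0)" if "y \<in> cells X" "f t \<le> f y" for y
    proof -
      have "V y t - (if y = t then 1 else 0) = 0"
        using V that tX unfolding strictly_upper_def by blast
      then show ?thesis by simp
    qed
    have supp: "\<forall>y\<in>cells X. c' y \<noteq> 0 \<longrightarrow> y \<in> D - {t}"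
    proof (intro ballI impI)
      fix y assume y: "y \<in> cells X" "c' y \<noteq> 0"
      have "y \<noteq> t" using y Vy[of t] tX by (auto simp: c'_def)
      moreover have "y \<in> D"
      proof (cases "f t \<le> f y")
        case True
        then show ?thesis using y Vy[of y] less.prems(3) \<open>y \<noteq> t\<close> by (auto simp: c'_def)
      next
        case False
        then have "f y \<le> f t" by simp
        then show ?thesis using less.prems(2) t(1) y(1) by blast
      qed
      ultimately show "y \<in> D - {t}" by simp
    qed
    have IH: "\<exists>y\<in>D - {t}. is_pivot (cells X) f R p y" if "leading (cells X) f (bd X c') p" for p
      using less.hyps[OF card _ down supp that] less.prems(1) by blast
    show ?case
    proof (cases "\<exists>x\<in>cells X. f s < f x \<and> c t * R x t \<noteq> 0")
      case True
      then obtain x where x: "x \<in> cells X" "f s < f x" "c t \<noteq> 0" "R x t \<noteq> 0" by auto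
      obtain p where p: "leading (cells X) f (\<lambda>x. R x t) p" "f x \<le> f p"
        using leading_exists[where z = "\<lambda>x. R x t" and f = f, OF fin x(1,4)] by blast
      have "leading (cells X) f (bd X c') p"
        using p x less.prems(4) bd' by (auto simp: leading_def)
      from IH[OF this] uniq p tX show ?thesis by (auto simp: is_pivot_iff_leading)
    next
      case False
      show ?thesis
      proof (cases "bd X c' s = 0")
        case True
        then have "c t * R s t \<noteq> 0" using less.prems(4) bd' by (auto simp: leading_def)
        then have "is_pivot (cells X) f R s t"
          using False less.prems(4) tX by (auto simp: is_pivot_def leading_def)
        then show ?thesis using t by blast
      next
        case nz: False
        then have "leading (cells X) f (bd X c') s"
          using less.prems(4) bd' False by (auto simp: leading_def)
        then show ?thesis using IH by blast
      qed
    qed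
  qed
  have "\<exists>y\<in>{y\<in>cells X. f y \<le> r}. is_pivot (cells X) f R s y"
    by (rule main[OF _ _ _ c(2)]) (use c(1) in \<open>auto simp: supported_def\<close>)
  then show ?thesis by blast
qed

text \<open>
  Among the chains that start from \<open>t\<close> and add earlier cells, one whose boundary has the lowest
  possible leading cell is reduced: if a chain of earlier cells had a boundary with the same leading
  cell, subtracting a multiple of it would lower the leading cell further. The height of the
  leading cell is measured by the number of cells up to it, which is 0 for the zero boundary.
\<close>

lemma reduced_column_exists:
  assumes fin: "finite (cells X)" and inj: "inj_on f (cells X)" and t: "t \<in> cells X"
  shows "\<exists>c. c t = 1 \<and> supported X f (f t) c \<and>
    (\<forall>s r. leading (cells X) f (bd X c) s \<longrightarrow> r < f t \<longrightarrow> \<not> killed_by X f r s)"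
proof -
  define P where "P c \<longleftrightarrow> c t = 1 \<and> supported X f (f t) c" for c
  define U where "U c = {x\<in>cells X. \<exists>y\<in>cells X. f x \<le> f y \<and> bd X c y \<noteq> 0}" for c
  have "P (\<lambda>y. if y = t then 1 else 0)" by (simp add: P_def supported_def)
  then obtain c where c: "P c" "\<And>d. P d \<Longrightarrow> card (U c) \<le> card (U d)"
    using ex_has_least_nat[of P _ "\<lambda>c. card (U c)"] by blast
  have False if s: "leading (cells X) f (bd X c) s" and r: "r < f t" and k: "killed_by X f r s" for s r
  proof -
    obtain d where d: "supported X f r d" "leading (cells X) f (bd X d) s"
      using k by (auto simp: killed_by_def)
    define q where "q = bd X c s / bd X d s"
    define e where "e = (\<lambda>y. c y - q * d y)"
    have "d t = 0" using d(1) r t by (force simp: supported_def)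
    then have "P e" using c(1) d(1) r by (force simp: P_def e_def supported_def)
    have bde: "bd X e x = bd X c x - q * bd X d x" for x by (simp add: e_def bd_diff_scale)
    have z: "bd X e x = 0" if "x \<in> cells X" "f s \<le> f x" for x
    proof (cases "x = s")
      case True
      then show ?thesis using d(2) by (simp add: bde q_def leading_def)
    next
      case False
      then have "f s < f x" using that s inj by (metis inj_onD leading_def order_less_le)
      then show ?thesis using that s d(2) by (simp add: bde leading_def)
    qed
    have "U e \<subseteq> U c"
    proof
      fix x assume "x \<in> U e"
      then obtain y where y: "x \<in> cells X" "y \<in> cells X" "f x \<le> f y" "bd X e y \<noteq> 0"
        by (auto simp: U_def)
      then have "f y < f s" using z by (meson not_le)
      then have "f x \<le> f s" using y by simp
      then show "x \<in> U c" using y s by (auto simp: U_def leading_def)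
    qed
    moreover have "s \<in> U c" using s by (auto simp: U_def leading_def)
    moreover have "s \<notin> U e" using z by (auto simp: U_def)
    ultimately have "U e \<subset> U c" by blast
    then have "card (U e) < card (U c)" using fin by (intro psubset_card_mono) (auto simp: U_def)
    then show False using c(2)[OF \<open>P e\<close>] by simp
  qed
  then show ?thesis using c(1) unfolding P_def by blast
qed

text \<open>
  The pivots of a reduced form, described by chains alone. In one direction, an earlier chain with
  leading cell \<open>s\<close> would produce a second pivot in row \<open>s\<close>. In the other, a reduced form is
  assembled from reduced columns; if column \<open>t\<close> did not have its pivot at \<open>s\<close>, its difference with
  a chain killing \<open>s\<close> would be a chain of earlier cells that contradicts either the choice of the
  column or the minimality of \<open>t\<close>.
\<close>

lemma BD_iff_first_killing:
  assumes fin: "finite (cells X)" and inj: "inj_on f (cells X)"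
  shows "(s, t) \<in> BD X f \<longleftrightarrow>
    t \<in> cells X \<and> killed_by X f (f t) s \<and> (\<forall>r<f t. \<not> killed_by X f r s)"
proof
  assume "(s, t) \<in> BD X f"
  then obtain R where R: "reduced_form X f R" "is_pivot (cells X) f R s t" by (auto simp: BD_def)
  then obtain V where V: "strictly_upper (cells X) f (\<lambda>x y. V x y - (if x = y then 1 else 0))"
    and R': "\<forall>x\<in>cells X. \<forall>t\<in>cells X. R x t = bd X (\<lambda>y. V y t) x"
    by (auto simp: reduced_form_def bd_def boundary_matrix_def mult.commute)
  have uniq: "\<forall>s t t'. is_pivot (cells X) f R s t \<and> is_pivot (cells X) f R s t' \<longrightarrow> t = t'"
    using R by (simp add: reduced_form_def)
  have t: "t \<in> cells X" using R(2) by (simp add: is_pivot_def)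
  have "supported X f (f t) (\<lambda>y. V y t)"
    unfolding supported_def
  proof (intro ballI impI)
    fix y assume y: "y \<in> cells X" "V y t \<noteq> 0"
    show "f y \<le> f t"
    proof (rule ccontr)
      assume n: "\<not> f y \<le> f t"
      then have "V y t - (if y = t then 1 else 0) = 0"
        using V y(1) t unfolding strictly_upper_def by (metis linear)
      then show False using y n by (cases "y = t") auto
    qed
  qed
  moreover have "leading (cells X) f (bd X (\<lambda>y. V y t)) s"
    using R(2) R' t by (auto simp: is_pivot_def leading_def)
  ultimately have "killed_by X f (f t) s" by (auto simp: killed_by_def)
  moreover have "\<not> killed_by X f r s" if "r < f t" for r
    using leading_of_reduced[OF fin inj V R' uniq] uniq R(2) that
    unfolding killed_by_def by (metis not_le)
  ultimately show "t \<in> cells X \<and> killed_by X f (f t) s \<and> (\<forall>r<f t. \<not> killed_by X f r s)"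
    using t by blast
next
  assume A: "t \<in> cells X \<and> killed_by X f (f t) s \<and> (\<forall>r<f t. \<not> killed_by X f r s)"
  obtain C where C: "\<And>t. t \<in> cells X \<Longrightarrow> C t t = 1 \<and> supported X f (f t) (C t) \<and>
      (\<forall>s r. leading (cells X) f (bd X (C t)) s \<longrightarrow> r < f t \<longrightarrow> \<not> killed_by X f r s)"
    using reduced_column_exists[OF fin inj] by metis
  define R where "R = (\<lambda>x t. bd X (C t) x)"
  have piv: "is_pivot (cells X) f R p u \<longleftrightarrow> u \<in> cells X \<and> leading (cells X) f (bd X (C u)) p" for p u
    by (simp add: is_pivot_iff_leading R_def)
  have "reduced_form X f R"
    unfolding reduced_form_def
  proof (intro conjI exI[of _ "\<lambda>x t. C t x"])
    show "strictly_upper (cells X) f (\<lambda>x y. C y x - (if x = y then 1 else 0))"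
      unfolding strictly_upper_def
    proof (intro ballI impI)
      fix x y assume xy: "x \<in> cells X" "y \<in> cells X" "f y \<le> f x"
      show "C y x - (if x = y then 1 else 0) = 0"
      proof (cases "x = y")
        case False
        then have "f y < f x" using xy inj by (metis inj_onD order_less_le)
        then show ?thesis using C[OF xy(2)] xy False by (force simp: supported_def)
      qed (use C xy in simp)
    qed
    show "\<forall>x\<in>cells X. \<forall>t\<in>cells X. R x t = (\<Sum>y\<in>cells X. boundary_matrix X x y * C t y)"
      by (simp add: R_def bd_def boundary_matrix_def mult.commute)
    have no: "\<not> f u < f u'" if "is_pivot (cells X) f R p u" "is_pivot (cells X) f R p u'" for p u u'
      using that C[of u] C[of u'] unfolding piv killed_by_def by blast
    show "\<forall>p u u'. is_pivot (cells X) f R p u \<and> is_pivot (cells X) f R p u' \<longrightarrow> u = u'"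
      using no inj by (metis inj_onD is_pivot_def linorder_neqE)
  qed
  moreover have "is_pivot (cells X) f R s t"
  proof (rule ccontr)
    assume np: "\<not> is_pivot (cells X) f R s t"
    obtain c where c: "supported X f (f t) c" "leading (cells X) f (bd X c) s"
      using A by (auto simp: killed_by_def)
    define e where "e = (\<lambda>y. c y - c t * C t y)"
    have bde: "bd X e x = bd X c x - c t * R x t" for x by (simp add: e_def bd_diff_scale R_def)
    obtain r where r: "r < f t" "\<forall>y\<in>cells X. f y < f t \<longrightarrow> f y \<le> r"
      using below_strict_bound[OF fin] by metis
    have "f y < f t" if "y \<in> cells X" "e y \<noteq> 0" for y
    proof -
      have "y \<noteq> t" using that C[of t] by (auto simp: e_def)
      moreover have "f y \<le> f t" using that c(1) C[of t] A by (force simp: e_def supported_def)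
      ultimately show ?thesis using that A inj by (metis inj_onD order_less_le)
    qed
    then have e: "supported X f r e" using r by (auto simp: supported_def)
    show False
    proof (cases "\<exists>x\<in>cells X. f s < f x \<and> c t * R x t \<noteq> 0")
      case True
      then obtain x where x: "x \<in> cells X" "f s < f x" "c t \<noteq> 0" "R x t \<noteq> 0" by auto
      obtain p where p: "leading (cells X) f (\<lambda>x. R x t) p" "f x \<le> f p"
        using leading_exists[where z = "\<lambda>x. R x t" and f = f, OF fin x(1,4)] by blast
      have "leading (cells X) f (bd X e) p" using p x c(2) bde by (auto simp: leading_def)
      then have "killed_by X f r p" using e by (auto simp: killed_by_def)
      then show False using C[of t] A p r by (auto simp: R_def)
    next
      case False
      have "c t * R s t = 0"
        using np False A c(2) by (auto simp: is_pivot_def leading_def)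
      then have "leading (cells X) f (bd X e) s" using c(2) bde False by (auto simp: leading_def)
      then have "killed_by X f r s" using e by (auto simp: killed_by_def)
      then show False using A r by blast
    qed
  qed
  ultimately show "(s, t) \<in> BD X f" by (auto simp: BD_def)
qed

section \<open>Cancelling a shallow pair\<close>

lemma cells_quotient [simp]: "cells (quotient_complex X (a, b)) = cells X - {a, b}"
  and inc_quotient [simp]: "inc (quotient_complex X (a, b)) y x =
         inc X y x - inverse (inc X b a) * inc X y a * inc X b x"
  and cdim_quotient [simp]: "cdim (quotient_complex X (a, b)) = cdim X"
  by (simp_all add: quotient_complex_def)

lemma SH_D:
  assumes "(a, b) \<in> SH X f"
  shows "a \<in> cells X" "b \<in> cells X" "inc X b a \<noteq> 0"
    and "\<And>x. x \<in> cells X \<Longrightarrow> inc X b x \<noteq> 0 \<Longrightarrow> f x \<le> f a"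
    and "\<And>y. y \<in> cells X \<Longrightarrow> inc X y a \<noteq> 0 \<Longrightarrow> f b \<le> f y"
  using assms by (auto simp: SH_def facet_def)

lemma SH_I:
  assumes "a \<in> cells X" "b \<in> cells X" "inc X b a \<noteq> 0"
    and "\<And>x. x \<in> cells X \<Longrightarrow> inc X b x \<noteq> 0 \<Longrightarrow> f x \<le> f a"
    and "\<And>y. y \<in> cells X \<Longrightarrow> inc X y a \<noteq> 0 \<Longrightarrow> f b \<le> f y"
  shows "(a, b) \<in> SH X f"
  using assms by (auto simp: SH_def facet_def)

lemma lefschetz_quotient:
  assumes X: "lefschetz_complex X" and ab: "(a, b) \<in> SH X f"
  shows "lefschetz_complex (quotient_complex X (a, b))"
proof -
  let ?Y = "quotient_complex X (a, b)"
  let ?k = "inverse (inc X b a)"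
  note S = SH_D[OF ab]
  have fin: "finite (cells X)" and dd: "\<And>z x. z \<in> cells X \<Longrightarrow> x \<in> cells X \<Longrightarrow>
      (\<Sum>y\<in>cells X. inc X z y * inc X y x) = 0"
    using X by (auto simp: lefschetz_complex_def)
  have "(\<Sum>y\<in>cells ?Y. inc ?Y z y * inc ?Y y x) = 0" if zx: "z \<in> cells X" "x \<in> cells X" for z x
  proof -
    \<comment> \<open>The two cancelled cells may be put back into the sum: the new incidences
        \<open>(z, a)\<close> and \<open>(b, x)\<close> given by the same formula vanish.\<close>
    have "(\<Sum>y\<in>cells ?Y. inc ?Y z y * inc ?Y y x) = (\<Sum>y\<in>cells X. inc ?Y z y * inc ?Y y x)"
      using fin S by (intro sum.mono_neutral_left) auto
    also have "\<dots> = (\<Sum>y\<in>cells X. inc X z y * inc X y x)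
        - ?k * inc X b x * (\<Sum>y\<in>cells X. inc X z y * inc X y a)
        - ?k * inc X z a * (\<Sum>y\<in>cells X. inc X b y * inc X y x)
        + ?k * inc X z a * ?k * inc X b x * (\<Sum>y\<in>cells X. inc X b y * inc X y a)"
      by (simp add: sum_distrib_left sum_subtractf[symmetric] sum.distrib[symmetric] algebra_simps)
    also have "\<dots> = 0" using dd zx S by simp
    finally show ?thesis .
  qed
  moreover have "cdim X y = cdim X x + 1"
    if "y \<in> cells X" "x \<in> cells X" "inc ?Y y x \<noteq> 0" for y x
  proof -
    have dim: "\<And>y x. y \<in> cells X \<Longrightarrow> x \<in> cells X \<Longrightarrow> inc X y x \<noteq> 0 \<Longrightarrow> cdim X y = cdim X x + 1"
      using X by (auto simp: lefschetz_complex_def)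
    show ?thesis
    proof (cases "inc X y x = 0")
      case True
      then have "inc X y a \<noteq> 0" "inc X b x \<noteq> 0" using that by auto
      then show ?thesis using dim[of y a] dim[of b x] dim[of b a] S that by simp
    qed (use dim that in auto)
  qed
  ultimately show ?thesis using fin by (simp add: lefschetz_complex_def)
qed

lemma lfilter_quotient:
  assumes f: "lfilter X f" and ab: "(a, b) \<in> SH X f"
  shows "lfilter (quotient_complex X (a, b)) f"
proof -
  note S = SH_D[OF ab]
  have "f x < f y" if "x \<in> cells X" "y \<in> cells X" "inc (quotient_complex X (a, b)) y x \<noteq> 0" for x y
  proof (cases "inc X y x = 0")
    case True
    then have "inc X y a \<noteq> 0" "inc X b x \<noteq> 0" using that by auto
    then have "f x \<le> f a" "f b \<le> f y" using S that by blast+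
    moreover have "f a < f b" using f S by (auto simp: lfilter_def facet_def)
    ultimately show ?thesis by simp
  qed (use f that in \<open>auto simp: lfilter_def facet_def\<close>)
  then show ?thesis using f by (auto simp: lfilter_def facet_def inj_on_def)
qed

lemma bd_bd:
  assumes X: "lefschetz_complex X" and x: "x \<in> cells X"
  shows "(\<Sum>y\<in>cells X. bd X c y * inc X y x) = 0"
proof -
  have "(\<Sum>y\<in>cells X. bd X c y * inc X y x)
      = (\<Sum>y\<in>cells X. \<Sum>z\<in>cells X. c z * (inc X z y * inc X y x))"
    by (simp add: bd_def sum_distrib_right mult.assoc)
  also have "\<dots> = (\<Sum>z\<in>cells X. c z * (\<Sum>y\<in>cells X. inc X z y * inc X y x))"
    by (subst sum.swap) (simp add: sum_distrib_left)
  also have "\<dots> = 0" using X x by (simp add: lefschetz_complex_def)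
  finally show ?thesis .
qed

text \<open>
  A cycle that contains \<open>b\<close> and vanishes above \<open>b\<close> cannot exist: \<open>b\<close> is the first cofacet of \<open>a\<close>,
  so nothing could cancel the contribution of \<open>b\<close> to the coefficient of \<open>a\<close> in the boundary of
  this cycle.
\<close>

lemma bd_zero_at_shallow_death:
  assumes X: "lefschetz_complex X" and f: "lfilter X f" and ab: "(a, b) \<in> SH X f"
    and z: "\<And>x. x \<in> cells X - {a, b} \<Longrightarrow> f b < f x \<Longrightarrow> bd X c x = 0"
  shows "bd X c b = 0"
proof -
  note S = SH_D[OF ab]
  have inj: "inj_on f (cells X)" using f by (simp add: lfilter_def)
  have aa: "inc X a a = 0" using f S by (force simp: lfilter_def facet_def)
  have "bd X c y * inc X y a = 0" if y: "y \<in> cells X - {b}" for y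
  proof (cases "inc X y a = 0 \<or> y = a")
    case False
    then have "f b \<le> f y" using S y by blast
    then have "f b < f y" using y S inj by (metis Diff_iff inj_onD insertI1 order_less_le)
    then show ?thesis using z False y by simp
  qed (use aa in auto)
  then have "(\<Sum>y\<in>cells X - {b}. bd X c y * inc X y a) = 0"
    by (intro sum.neutral) blast
  then have "(\<Sum>y\<in>cells X. bd X c y * inc X y a) = bd X c b * inc X b a"
    using X S by (simp add: sum.remove[of _ b] lefschetz_complex_def)
  then show ?thesis using bd_bd[OF X S(1), of c] S(3) by simp
qed

lemma killed_by_shallow_birth:
  assumes "lefschetz_complex X" "(a, b) \<in> SH X f"
  shows "killed_by X f r a \<longleftrightarrow> f b \<le> r"
proof
  note S = SH_D[OF assms(2)]
  assume "killed_by X f r a"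
  then obtain c where c: "supported X f r c" "bd X c a \<noteq> 0"
    by (auto simp: killed_by_def leading_def)
  then obtain y where "y \<in> cells X" "c y * inc X y a \<noteq> 0"
    unfolding bd_def by (metis (mono_tags, lifting) sum.neutral)
  then show "f b \<le> r" using c S by (force simp: supported_def)
next
  note S = SH_D[OF assms(2)]
  assume r: "f b \<le> r"
  define c where "c = (\<lambda>y. if y = b then 1 else 0 :: 'b)"
  have "bd X c x = inc X b x" for x
    using assms S unfolding bd_def c_def
    by (simp add: lefschetz_complex_def if_distrib[of "\<lambda>u. u * _"] cong: if_cong)
  then have "leading (cells X) f (bd X c) a" using S by (force simp: leading_def)
  moreover have "supported X f r c" using r by (simp add: supported_def c_def)
  ultimately show "killed_by X f r a" by (auto simp: killed_by_def)
qed

lemma not_killed_by_shallow_death: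
  assumes "lefschetz_complex X" "lfilter X f" "(a, b) \<in> SH X f"
  shows "\<not> killed_by X f r b"
  using bd_zero_at_shallow_death[OF assms] by (force simp: killed_by_def leading_def)

text \<open>
  A chain of the quotient is lifted by adding the multiple of \<open>b\<close> that makes the coefficient of
  \<open>a\<close> in the boundary vanish. Conversely, a chain of the complex is first freed of \<open>a\<close> by
  subtracting a multiple of the boundary of \<open>b\<close>, which does not change its boundary, and is then
  restricted to the quotient.
\<close>

lemma killed_by_quotient:
  assumes X: "lefschetz_complex X" and f: "lfilter X f" and ab: "(a, b) \<in> SH X f"
    and s: "s \<in> cells X - {a, b}"
  shows "killed_by (quotient_complex X (a, b)) f r s \<longleftrightarrow> killed_by X f r s"
proof -
  let ?Y = "quotient_complex X (a, b)"
  let ?k = "inverse (inc X b a)"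
  note S = SH_D[OF ab]
  have fin: "finite (cells X)" using X by (simp add: lefschetz_complex_def)
  have inj: "inj_on f (cells X)" using f by (simp add: lfilter_def)
  have fab: "f a < f b" using f S by (auto simp: lfilter_def facet_def)
  then have "a \<noteq> b" by auto
  have aa: "inc X a a = 0" using f S by (force simp: lfilter_def facet_def)
  have split: "(\<Sum>y\<in>cells X. g y) = g a + g b + (\<Sum>y\<in>cells ?Y. g y)" for g :: "'a \<Rightarrow> 'b"
  proof -
    have "(\<Sum>y\<in>cells X. g y) = g a + (\<Sum>y\<in>cells X - {a}. g y)"
      using fin S by (simp add: sum.remove)
    also have "(\<Sum>y\<in>cells X - {a}. g y) = g b + (\<Sum>y\<in>cells X - {a} - {b}. g y)"
      using fin S \<open>a \<noteq> b\<close> by (simp add: sum.remove)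
    also have "cells X - {a} - {b} = cells ?Y" by auto
    finally show ?thesis by (simp add: add.assoc)
  qed
  have bdY: "bd ?Y c x = (\<Sum>y\<in>cells ?Y. c y * inc X y x)
      - ?k * (\<Sum>y\<in>cells ?Y. c y * inc X y a) * inc X b x" for c x
    by (simp add: bd_def sum_distrib_left sum_distrib_right sum_subtractf[symmetric] algebra_simps)
  show ?thesis
  proof
    assume "killed_by ?Y f r s"
    then obtain c where c: "supported ?Y f r c" "leading (cells ?Y) f (bd ?Y c) s"
      by (auto simp: killed_by_def)
    \<comment> \<open>\<open>d\<close> is the lift of \<open>c\<close>. Cofacets of \<open>a\<close> come after \<open>b\<close>, so adding \<open>b\<close> keeps the
        support below \<open>r\<close>.\<close>
    define m where "m = (\<Sum>y\<in>cells ?Y. c y * inc X y a)"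
    define d where "d = (\<lambda>y. if y = a then 0 else if y = b then - ?k * m else c y)"
    have dY: "(\<Sum>y\<in>cells ?Y. d y * inc X y x) = (\<Sum>y\<in>cells ?Y. c y * inc X y x)" for x
      by (intro sum.cong) (auto simp: d_def)
    have bdd: "bd X d x = bd ?Y c x" for x
      unfolding bd_def[of X d] split dY bdY using \<open>a \<noteq> b\<close> by (simp add: d_def m_def)
    have da: "bd X d a = 0" unfolding bdd bdY using S(3) by simp
    have "f b \<le> r" if m: "m \<noteq> 0"
    proof -
      obtain y where "y \<in> cells ?Y" "c y * inc X y a \<noteq> 0"
        using m unfolding m_def by (metis (mono_tags, lifting) sum.neutral)
      then have "y \<in> cells X" "f y \<le> r" "inc X y a \<noteq> 0"
        using c(1) by (auto simp: supported_def)
      then show ?thesis using S(5)[of y] by simp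
    qed
    then have "supported X f r d" using c(1) by (auto simp: supported_def d_def)
    moreover have "leading (cells X) f (bd X d) s"
    proof -
      have z: "bd X d x = 0" if "x \<in> cells X - {a, b}" "f s < f x" for x
        using c(2) that by (simp add: bdd leading_def)
      have "bd X d b = 0" if "f s < f b"
        using z that by (intro bd_zero_at_shallow_death[OF X f ab]) auto
      then show ?thesis using z da s c(2) by (auto simp: leading_def bdd)
    qed
    ultimately show "killed_by X f r s" by (auto simp: killed_by_def)
  next
    assume "killed_by X f r s"
    then obtain c where c: "supported X f r c" "leading (cells X) f (bd X c) s"
      by (auto simp: killed_by_def)
    define d where "d = (\<lambda>y. c y - (c a * ?k) * inc X b y)"
    have da: "d a = 0" using S by (simp add: d_def)
    have bdd: "bd X d x = bd X c x" if "x \<in> cells X" for x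
    proof -
      have "bd X (inc X b) x = 0" using X S that by (simp add: bd_def lefschetz_complex_def)
      then show ?thesis by (simp add: d_def bd_diff_scale)
    qed
    have sd: "supported X f r d"
      unfolding supported_def
    proof (intro ballI impI)
      fix y assume y: "y \<in> cells X" "d y \<noteq> 0"
      show "f y \<le> r"
      proof (cases "c y = 0")
        case True
        then have "c a \<noteq> 0" "inc X b y \<noteq> 0" using y by (auto simp: d_def)
        then have "f a \<le> r" "f y \<le> f a" using c S y by (auto simp: supported_def)
        then show ?thesis by simp
      qed (use c y in \<open>simp add: supported_def\<close>)
    qed
    have bY: "bd ?Y d x = bd X d x - ?k * bd X d a * inc X b x" for x
      unfolding bd_def[of X d] split bdY using da S(3) by (simp add: algebra_simps)
    have "leading (cells ?Y) f (bd ?Y d) s"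
    proof -
      \<comment> \<open>The correction by \<open>b\<close> only concerns cells up to \<open>a\<close>. So it leaves the boundary
          unchanged at \<open>s\<close> and above, unless \<open>a\<close> lies above \<open>s\<close>; but then \<open>a\<close> does not occur
          in the boundary of \<open>d\<close> and there is no correction.\<close>
      have "bd X d a * inc X b x = 0" if "x \<in> cells X" "f s \<le> f x" for x
      proof (cases "f s < f a")
        case True
        then show ?thesis using c(2) S bdd by (simp add: leading_def)
      next
        case False
        then have "f a < f x" using that s S inj
          by (metis Diff_iff inj_onD insertI1 linorder_neqE order_less_le_trans)
        then show ?thesis using S(4) that by force
      qed
      then show ?thesis using c(2) s by (auto simp: leading_def bY bdd mult.assoc)
    qed
    then show "killed_by ?Y f r s" using sd by (auto simp: killed_by_def supported_def)
  qed
qed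

text \<open>
  By the description through chains, births other than \<open>a\<close> and \<open>b\<close> have the same first killing
  level in the complex and in the quotient. This level is never that of \<open>a\<close> or \<open>b\<close>, because it
  is attained by a cell of the quotient.
\<close>

lemma BD_quotient:
  assumes X: "lefschetz_complex X" and f: "lfilter X f" and ab: "(a, b) \<in> SH X f"
  shows "BD X f = insert (a, b) (BD (quotient_complex X (a, b)) f)"
    and "(a, b) \<notin> BD (quotient_complex X (a, b)) f"
proof -
  let ?Y = "quotient_complex X (a, b)"
  note S = SH_D[OF ab]
  have fin: "finite (cells X)" "finite (cells ?Y)" using X by (auto simp: lefschetz_complex_def)
  have inj: "inj_on f (cells X)" "inj_on f (cells ?Y)" using f by (auto simp: lfilter_def inj_on_def)
  note BDX = BD_iff_first_killing[OF fin(1) inj(1)] and BDY = BD_iff_first_killing[OF fin(2) inj(2)]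
  note K = killed_by_quotient[OF X f ab]
  have cell: "killed_by Z f r s \<Longrightarrow> s \<in> cells Z" for Z :: "('a, 'b) lcomplex" and r s
    by (auto simp: killed_by_def leading_def)
  have "(s, t) \<in> BD X f \<longleftrightarrow> (s, t) = (a, b) \<or> (s, t) \<in> BD ?Y f" for s t
  proof (cases "s \<in> cells X - {a, b}")
    case True
    have "t \<in> cells ?Y" if t: "(s, t) \<in> BD X f"
    proof -
      have "killed_by ?Y f (f t) s" using t K[OF True] BDX by blast
      then obtain t' where t': "t' \<in> cells ?Y" "f t' \<le> f t" "killed_by ?Y f (f t') s"
        using killed_by_cell[OF fin(2)] by blast
      then have "f t' = f t" using t K[OF True] BDX by (metis order_less_le)
      then show ?thesis using t' t inj(1) BDX by (metis Diff_iff cells_quotient inj_onD)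
    qed
    then show ?thesis using True BDX BDY K[OF True] by auto
  next
    case False
    then have nY: "(s, t) \<notin> BD ?Y f" using BDY cell by fastforce
    show ?thesis
    proof (cases "s = a")
      case True
      have "(a, t) \<in> BD X f \<longleftrightarrow> t \<in> cells X \<and> f b = f t"
        unfolding BDX killed_by_shallow_birth[OF X ab]
        by (metis leD linorder_neqE order_le_less)
      then show ?thesis using True nY S inj(1) by (auto simp: inj_on_def)
    next
      case sa: False
      then have "(s, t) \<notin> BD X f"
        using False BDX cell not_killed_by_shallow_death[OF X f ab] by blast
      then show ?thesis using sa nY by auto
    qed
  qed
  then show "BD X f = insert (a, b) (BD ?Y f)" by auto
  show "(a, b) \<notin> BD ?Y f" using BDY cell by fastforce
qed

lemma SH_subset_BD:
  "lefschetz_complex X \<Longrightarrow> lfilter X f \<Longrightarrow> SH X f \<subseteq> BD X f"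
  using BD_quotient(1) by fastforce

text \<open>
  If \<open>(s, t)\<close> minimizes \<open>f t - f s\<close> among all facet relations, then a facet of \<open>t\<close> above \<open>s\<close>, or a
  cofacet of \<open>s\<close> below \<open>t\<close>, would give a smaller difference.
\<close>

lemma SH_nonempty:
  assumes X: "lefschetz_complex X" and f: "lfilter X f" and B: "BD X f \<noteq> {}"
  shows "SH X f \<noteq> {}"
proof -
  have fin: "finite (cells X)" using X by (simp add: lefschetz_complex_def)
  let ?E = "{(s, t). facet X s t}"
  have "?E \<noteq> {}"
  proof
    assume "?E = {}"
    then have "bd X c x = 0" if "x \<in> cells X" for c x
      using that by (auto simp: bd_def facet_def intro!: sum.neutral)
    then have "\<not> killed_by X f r s" for r s by (auto simp: killed_by_def leading_def)
    moreover have "inj_on f (cells X)" using f by (simp add: lfilter_def)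
    ultimately show False using B BD_iff_first_killing[OF fin] by auto
  qed
  moreover have "finite ?E"
    by (rule finite_subset[of _ "cells X \<times> cells X"]) (use fin in \<open>auto simp: facet_def\<close>)
  ultimately obtain p where p: "p \<in> ?E" "\<And>q. q \<in> ?E \<Longrightarrow> f (snd p) - f (fst p) \<le> f (snd q) - f (fst q)"
    using ex_is_arg_min_if_finite[of ?E "\<lambda>q. f (snd q) - f (fst q)"]
    unfolding is_arg_min_def by (metis not_less)
  obtain s t where st: "p = (s, t)" by (cases p)
  have "f x \<le> f s" if "facet X x t" for x using p(2)[of "(x, t)"] that st by simp
  moreover have "f t \<le> f y" if "facet X s y" for y using p(2)[of "(s, y)"] that st by simp
  ultimately have "(s, t) \<in> SH X f" using p st by (simp add: SH_def)
  then show ?thesis by blast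
qed

section \<open>Interaction of two shallow pairs\<close>

text \<open>
  Otherwise the path through \<open>t\<close> would be the only contribution to the \<open>(u, s)\<close> entry of the
  squared boundary. This excludes that a cell is both the first cofacet of \<open>s\<close>
  and the last facet of \<open>u\<close>.
\<close>

lemma sole_intermediate_cell:
  assumes X: "lefschetz_complex X" and "u \<in> cells X" "t \<in> cells X" "s \<in> cells X"
    and sole: "\<And>y. y \<in> cells X \<Longrightarrow> inc X u y \<noteq> 0 \<Longrightarrow> inc X y s \<noteq> 0 \<Longrightarrow> y = t"
  shows "inc X u t = 0 \<or> inc X t s = 0"
proof -
  have fin: "finite (cells X)" and dd: "(\<Sum>y\<in>cells X. inc X u y * inc X y s) = 0"
    using assms by (auto simp: lefschetz_complex_def)
  have "(\<Sum>y\<in>cells X - {t}. inc X u y * inc X y s) = 0"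
    using sole by (intro sum.neutral) auto
  then show ?thesis using dd sum.remove[OF fin assms(3), of "\<lambda>y. inc X u y * inc X y s"] by simp
qed

text \<open>
  In a shallow pair each cell determines the other one, as last facet or as first cofacet. If
  \<open>(s, t)\<close> and \<open>(t, u)\<close> were both shallow, \<open>t\<close> would be the only cell between \<open>s\<close> and \<open>u\<close>.
\<close>

lemma shallow_pairs_disjoint:
  assumes X: "lefschetz_complex X" and f: "lfilter X f"
    and 1: "(s1, t1) \<in> SH X f" and 2: "(s2, t2) \<in> SH X f" and ne: "(s1, t1) \<noteq> (s2, t2)"
  shows "s1 \<noteq> s2" "t1 \<noteq> t2" "s1 \<noteq> t2" "t1 \<noteq> s2"
proof -
  note S1 = SH_D[OF 1] and S2 = SH_D[OF 2]
  have inj: "\<And>x y. x \<in> cells X \<Longrightarrow> y \<in> cells X \<Longrightarrow> f x = f y \<Longrightarrow> x = y"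
    using f by (auto simp: lfilter_def inj_on_def)
  show s: "s1 \<noteq> s2"
  proof
    assume e: "s1 = s2"
    then have "f t1 \<le> f t2" "f t2 \<le> f t1" using S1 S2 by auto
    then show False using inj[of t1 t2] S1(2) S2(2) e ne by simp
  qed
  show t: "t1 \<noteq> t2"
  proof
    assume e: "t1 = t2"
    then have "f s1 \<le> f s2" "f s2 \<le> f s1" using S1 S2 by auto
    then show False using inj[of s1 s2] S1(1) S2(1) s by simp
  qed
  have no: False if p: "(s, t) \<in> SH X f" and q: "(t, u) \<in> SH X f" for s t u
  proof -
    note P = SH_D[OF p] and Q = SH_D[OF q]
    have "y = t" if "y \<in> cells X" "inc X u y \<noteq> 0" "inc X y s \<noteq> 0" for y
      using P(5)[OF that(1,3)] Q(4)[OF that(1,2)] inj[OF that(1) P(2)] by simp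
    then show False using sole_intermediate_cell[OF X Q(2) P(2) P(1)] P(3) Q(3) by blast
  qed
  show "s1 \<noteq> t2" "t1 \<noteq> s2" using no 1 2 by blast+
qed

text \<open>
  The incidences between the births and the deaths of two shallow pairs form a triangular matrix.
  This makes the two Schur complements independent of their order.
\<close>

lemma shallow_pairs_triangular:
  assumes f: "lfilter X f" and 1: "(s1, t1) \<in> SH X f" and 2: "(s2, t2) \<in> SH X f" and "s1 \<noteq> s2"
  shows "inc X t1 s2 = 0 \<or> inc X t2 s1 = 0"
proof (rule ccontr)
  note S1 = SH_D[OF 1] and S2 = SH_D[OF 2]
  assume "\<not> ?thesis"
  then have "f s2 \<le> f s1" "f s1 \<le> f s2" using S1 S2 by auto
  then show False using S1 S2 f assms(4) by (auto simp: lfilter_def inj_on_def)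
qed

lemma shallow_persist:
  assumes X: "lefschetz_complex X" and f: "lfilter X f"
    and 1: "(s1, t1) \<in> SH X f" and 2: "(s2, t2) \<in> SH X f" and ne: "(s1, t1) \<noteq> (s2, t2)"
  shows "(s2, t2) \<in> SH (quotient_complex X (s1, t1)) f"
proof (rule SH_I)
  note S1 = SH_D[OF 1] and S2 = SH_D[OF 2] and dis = shallow_pairs_disjoint[OF X f 1 2 ne]
  show "s2 \<in> cells (quotient_complex X (s1, t1))" "t2 \<in> cells (quotient_complex X (s1, t1))"
    using S1 S2 dis by auto
  show "inc (quotient_complex X (s1, t1)) t2 s2 \<noteq> 0"
    using shallow_pairs_triangular[OF f 1 2 dis(1)] S2 by auto
  show "f x \<le> f s2"
    if "x \<in> cells (quotient_complex X (s1, t1))" "inc (quotient_complex X (s1, t1)) t2 x \<noteq> 0" for x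
  proof (cases "inc X t2 x = 0")
    case True
    then have "inc X t2 s1 \<noteq> 0" "inc X t1 x \<noteq> 0" using that by auto
    then have "f x \<le> f s1" "f s1 \<le> f s2" using S1 S2 that by auto
    then show ?thesis by simp
  qed (use S2 that in auto)
  show "f t2 \<le> f y"
    if "y \<in> cells (quotient_complex X (s1, t1))" "inc (quotient_complex X (s1, t1)) y s2 \<noteq> 0" for y
  proof (cases "inc X y s2 = 0")
    case True
    then have "inc X y s1 \<noteq> 0" "inc X t1 s2 \<noteq> 0" using that by auto
    then have "f t1 \<le> f y" "f t2 \<le> f t1" using S1 S2 that by auto
    then show ?thesis by simp
  qed (use S2 that in auto)
qed

lemma shallow_commute:
  assumes X: "lefschetz_complex X" and f: "lfilter X f"
    and 1: "(s1, t1) \<in> SH X f" and 2: "(s2, t2) \<in> SH X f" and ne: "(s1, t1) \<noteq> (s2, t2)"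
  shows "quotient_complex (quotient_complex X (s1, t1)) (s2, t2) =
         quotient_complex (quotient_complex X (s2, t2)) (s1, t1)"
proof -
  let ?L = "quotient_complex (quotient_complex X (s1, t1)) (s2, t2)"
  let ?R = "quotient_complex (quotient_complex X (s2, t2)) (s1, t1)"
  have nz: "inc X t1 s1 \<noteq> 0" "inc X t2 s2 \<noteq> 0" using SH_D(3)[OF 1] SH_D(3)[OF 2] by auto
  have "inc X t1 s2 = 0 \<or> inc X t2 s1 = 0"
    using shallow_pairs_triangular[OF f 1 2] shallow_pairs_disjoint[OF X f 1 2 ne] by blast
  then have "inc ?L y x = inc ?R y x" for y x
    using nz by (auto simp: field_simps)
  then have "inc ?L = inc ?R" by (intro ext)
  moreover have "cells ?L = cells ?R" "cdim ?L = cdim ?R" by auto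
  ultimately show ?thesis by (intro lcomplex.equality) auto
qed

text \<open>
  Suppose that the last facet \<open>u\<close> of \<open>t\<close> lies above \<open>s\<close>. If \<open>(s, t)\<close> is shallow after cancelling
  \<open>(a, b)\<close>, this cancellation destroys the incidence of \<open>u\<close> and \<open>t\<close>. It cannot do so by changing
  the coefficient: that would require \<open>a\<close> to be a facet of \<open>t\<close> and \<open>u\<close> to be a facet of \<open>b\<close>,
  hence \<open>u\<close> to be both after and before \<open>a\<close>. So it removes \<open>u\<close>, and then \<open>u = a\<close>. As \<open>u\<close> is
  the birth of at most one of the two pairs, there is no such \<open>u\<close>. The cofacets of \<open>s\<close> are
  treated dually.
\<close>

lemma shallow_meet:
  assumes X: "lefschetz_complex X" and f: "lfilter X f"
    and 1: "(s1, t1) \<in> SH X f" and 2: "(s2, t2) \<in> SH X f" and ne: "(s1, t1) \<noteq> (s2, t2)"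
    and e1: "(s, t) \<in> SH (quotient_complex X (s1, t1)) f"
    and e2: "(s, t) \<in> SH (quotient_complex X (s2, t2)) f"
  shows "(s, t) \<in> SH X f"
proof (rule SH_I)
  note dis = shallow_pairs_disjoint[OF X f 1 2 ne]
  have fin: "finite (cells X)" using X by (simp add: lefschetz_complex_def)
  have inj: "\<And>x y. x \<in> cells X \<Longrightarrow> y \<in> cells X \<Longrightarrow> f x = f y \<Longrightarrow> x = y"
    using f by (auto simp: lfilter_def inj_on_def)
  show s: "s \<in> cells X" and t: "t \<in> cells X" using SH_D[OF e1] by auto
  \<comment> \<open>\<open>u\<close> cannot be removed as the death \<open>b\<close>: it would be the only cell between \<open>a\<close> and \<open>t\<close>.\<close>
  have top: "u = a"
    if ab: "(a, b) \<in> SH X f" and st: "(s, t) \<in> SH (quotient_complex X (a, b)) f"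
      and u: "u \<in> cells X" "inc X t u \<noteq> 0" "\<And>x. x \<in> cells X \<Longrightarrow> inc X t x \<noteq> 0 \<Longrightarrow> f x \<le> f u"
      and fu: "f s < f u" for a b u
  proof (rule ccontr)
    assume "u \<noteq> a"
    note A = SH_D[OF ab] and E = SH_D[OF st]
    have "u \<noteq> b"
    proof
      assume ub: "u = b"
      have "y = b" if y: "y \<in> cells X" "inc X t y \<noteq> 0" "inc X y a \<noteq> 0" for y
        using u(3)[OF y(1,2)] A(5)[OF y(1,3)] inj[OF y(1) A(2)] ub by simp
      then show False using sole_intermediate_cell[OF X t A(2) A(1)] A(3) u(2) ub by blast
    qed
    then have "inc (quotient_complex X (a, b)) t u = 0"
      using E(4)[of u] u \<open>u \<noteq> a\<close> fu by (metis Diff_iff cells_quotient empty_iff insertE not_less)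
    then have "inc X t a \<noteq> 0" "inc X b u \<noteq> 0" using u(2) by auto
    then have "f a \<le> f u" "f u \<le> f a" using u A by auto
    then show False using \<open>u \<noteq> a\<close> inj[of u a] u(1) A(1) by simp
  qed
  show facets: "f x \<le> f s" if x: "x \<in> cells X" "inc X t x \<noteq> 0" for x
  proof (rule ccontr)
    assume "\<not> f x \<le> f s"
    let ?B = "{x\<in>cells X. inc X t x \<noteq> 0}"
    have "finite ?B" "?B \<noteq> {}" using fin x by auto
    then obtain u where u: "u \<in> ?B" "\<And>y. y \<in> ?B \<Longrightarrow> f y \<le> f u"
      using argmax_exists[of ?B f] by blast
    then have "f s < f u" using x \<open>\<not> f x \<le> f s\<close> by force
    then have "u = s1" "u = s2" using top[OF 1 e1, of u] top[OF 2 e2, of u] u by auto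
    then show False using dis by simp
  qed
  have bot: "v = b"
    if ab: "(a, b) \<in> SH X f" and st: "(s, t) \<in> SH (quotient_complex X (a, b)) f"
      and v: "v \<in> cells X" "inc X v s \<noteq> 0" "\<And>y. y \<in> cells X \<Longrightarrow> inc X y s \<noteq> 0 \<Longrightarrow> f v \<le> f y"
      and fv: "f v < f t" for a b v
  proof (rule ccontr)
    assume "v \<noteq> b"
    note A = SH_D[OF ab] and E = SH_D[OF st]
    have "v \<noteq> a"
    proof
      assume va: "v = a"
      have "y = a" if y: "y \<in> cells X" "inc X b y \<noteq> 0" "inc X y s \<noteq> 0" for y
        using v(3)[OF y(1,3)] A(4)[OF y(1,2)] inj[OF y(1) A(1)] va by simp
      then show False using sole_intermediate_cell[OF X A(2) A(1) s] A(3) v(2) va by blast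
    qed
    then have "inc (quotient_complex X (a, b)) v s = 0"
      using E(5)[of v] v \<open>v \<noteq> b\<close> fv by (metis Diff_iff cells_quotient empty_iff insertE not_less)
    then have "inc X v a \<noteq> 0" "inc X b s \<noteq> 0" using v(2) by auto
    then have "f b \<le> f v" "f v \<le> f b" using v A by auto
    then show False using \<open>v \<noteq> b\<close> inj[of v b] v(1) A(2) by simp
  qed
  show "f t \<le> f y" if y: "y \<in> cells X" "inc X y s \<noteq> 0" for y
  proof (rule ccontr)
    assume "\<not> f t \<le> f y"
    let ?B = "{y\<in>cells X. inc X y s \<noteq> 0}"
    have "finite ?B" "?B \<noteq> {}" using fin y by auto
    then obtain v where v: "v \<in> ?B" "\<And>y. y \<in> ?B \<Longrightarrow> f v \<le> f y"
      using ex_is_arg_min_if_finite[of ?B f] unfolding is_arg_min_def by (metis (no_types, lifting) not_less)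
    then have "f v < f t" using y \<open>\<not> f t \<le> f y\<close> by force
    then have "v = t1" "v = t2" using bot[OF 1 e1, of v] bot[OF 2 e2, of v] v by auto
    then show False using dis by simp
  qed
  show "inc X t s \<noteq> 0"
  proof
    assume z: "inc X t s = 0"
    then have "inc X t s1 \<noteq> 0" "inc X t1 s \<noteq> 0" using SH_D(3)[OF e1] by auto
    then have "f s1 \<le> f s" "f s \<le> f s1" using facets SH_D[OF 1] s by auto
    then show False using inj[of s s1] SH_D(1)[OF e1] SH_D(1)[OF 1] by auto
  qed
qed

section \<open>Shallow cancelable sets\<close>

lemma shallow_firing_process:
  "firing_process (\<lambda>X :: ('a, 'k::field) lcomplex. lefschetz_complex X \<and> lfilter X f)
     (\<lambda>X. SH X f) quotient_complex (\<lambda>X. BD X f)"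
proof
  fix X :: "('a, 'k) lcomplex" and a b e :: "'a \<times> 'a"
  obtain a1 a2 b1 b2 e1 e2 where ab: "a = (a1, a2)" "b = (b1, b2)" "e = (e1, e2)"
    by (cases a, cases b, cases e)
  assume "lefschetz_complex X \<and> lfilter X f"
  then have X: "lefschetz_complex X" and f: "lfilter X f" by auto
  show "finite (BD X f)"
    by (rule finite_subset[of _ "cells X \<times> cells X"])
      (use X in \<open>auto simp: BD_def is_pivot_def lefschetz_complex_def\<close>)
  show "SH X f \<subseteq> BD X f" using SH_subset_BD[OF X f] .
  show "BD X f \<noteq> {} \<Longrightarrow> SH X f \<noteq> {}" using SH_nonempty[OF X f] .
  assume a: "a \<in> SH X f"
  show "lefschetz_complex (quotient_complex X a) \<and> lfilter (quotient_complex X a) f"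
    using lefschetz_quotient[OF X] lfilter_quotient[OF f] a by (simp add: ab)
  show "BD (quotient_complex X a) f = BD X f - {a}"
    using BD_quotient[OF X f] a by (simp add: ab)
  assume b: "b \<in> SH X f" and ne: "a \<noteq> b"
  show "b \<in> SH (quotient_complex X a) f"
    using shallow_persist[OF X f] a b ne by (simp add: ab)
  show "quotient_complex (quotient_complex X a) b = quotient_complex (quotient_complex X b) a"
    using shallow_commute[OF X f] a b ne unfolding ab by blast
  assume "e \<in> SH (quotient_complex X a) f" "e \<in> SH (quotient_complex X b) f"
  then show "e \<in> SH X f" using shallow_meet[OF X f] a b ne unfolding ab by blast
qed

theorem proposition7p8:
  fixes X :: "('a, 'k::field) lcomplex"
    and f :: "'a \<Rightarrow> real"
    and S :: "('a \<times> 'a) set"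
  assumes "lefschetz_complex X"
    and "lfilter X f"
    and "S \<subseteq> BD X f"
  shows "shallow_cancelable X f S \<longleftrightarrow> depth_down_set X f S"
proof -
  interpret firing_process "\<lambda>X :: ('a, 'k) lcomplex. lefschetz_complex X \<and> lfilter X f"
    "\<lambda>X. SH X f" quotient_complex "\<lambda>X. BD X f"
    by (rule shallow_firing_process)
  have X: "lefschetz_complex X \<and> lfilter X f" using assms by simp
  have order: "shallow_order X f \<Phi> \<longleftrightarrow> run X \<Phi> \<and> set \<Phi> = BD X f" for \<Phi>
    using run_pool[OF X] by (auto simp: shallow_order_def cancel_all_def run_iff_nth)
  have "shallow_cancelable X f S \<longleftrightarrow> feasible X S"
  proof
    assume "shallow_cancelable X f S"
    then obtain \<Phi> k where "run X \<Phi>" "S = set (take k \<Phi>)"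
      by (auto simp: shallow_cancelable_def order)
    moreover then have "run X (take k \<Phi>)"
      using run_append[of X "take k \<Phi>" "drop k \<Phi>"] by simp
    ultimately show "feasible X S" by (auto simp: feasible_def)
  next
    assume "feasible X S"
    then obtain as where as: "run X as" "set as = S" by (auto simp: feasible_def)
    obtain bs where "run X (as @ bs)" "set (as @ bs) = BD X f"
      using run_complete[OF X as(1)] by blast
    then show "shallow_cancelable X f S"
      unfolding shallow_cancelable_def order using as
      by (intro exI[of _ "as @ bs"] exI[of _ "length as"]) simp
  qed
  also have "\<dots> \<longleftrightarrow> depth_down_set X f S"
    unfolding feasible_iff_down_set[OF X assms(3)] depth_down_set_def depth_le_def order
    using assms(3) by blast
  finally show ?thesis .
qed

end
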